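(* Let $\lambda\in\mathbb{R}\setminus\{0\}$, let $r$ be a nonnegative integer, $m$ an integer with $m\ge0$ and $p$ a nonnegative integer. Then for real $x$ with $|x|<1$, \begin{align*} &\frac{1}{m!}\bigg(\frac{d}{dx}\bigg)^{m}\bigg[\frac{x^{m}}{(1-x)^{2}}F_{p,\lambda}\bigg(\frac{x}{1-x}\bigg|r\bigg)\bigg]-\bigg(x\frac{d}{dx}+r\bigg)_{p,\lambda}\bigg(\frac{1}{1-x}\bigg)^{m+1} \\ &=\sum_{k=0}^{\infty}(k+r)_{p,\lambda}\bigg(\bigg(\frac{1}{1-x}\bigg)^{m+1}-\sum_{l=0}^{k}\binom{m+l}{l}x^{l}\bigg). \end{align*}
   Context: For $\lambda\neq0$, $(x)_{0,\lambda}=1$ and $(x)_{n,\lambda}=x(x-\lambda)\cdots(x-(n-1)\lambda)$ for $n\ge1$; $e_{\lambda}^{x}(t)=(1+\lambda t)^{x/\lambda}$, $e_\lambda(t)=e_\lambda^1(t)$. The two variable degenerate Fubini polynomials $F_{n,\lambda}(x|r)$ are defined by $\frac{1}{1-x(e_{\lambda}(t)-1)}e_{\lambda}^{r}(t)=\sum_{n=0}^{\infty}F_{n,\lambda}(x|r)\frac{t^{n}}{n!}$. The degenerate differential operator is $\big(x\frac{d}{dx}+r\big)_{p,\lambda}=\big(x\frac{d}{dx}+r\big)\big(x\frac{d}{dx}+r-\lambda\big)\cdots\big(x\frac{d}{dx}+r-(p-1)\lambda\big)$ for $p\ge1$, and the identity operator for $p=0$. *)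

theory Defs
  imports "HOL-Analysis.Analysis" "HOL-Computational_Algebra.Formal_Power_Series"
begin

definition degen_fact :: "real \<Rightarrow> real \<Rightarrow> nat \<Rightarrow> real" where
  "degen_fact l x n = (\<Prod>i<n. x - real i * l)"

(* The degenerate exponential (1 + l t) powr (x / l) as a formal power series in t,
   for l \<noteq> 0; degen_exp_sums and degen_exp_nth below give its sum and coefficients. *)
definition degen_exp :: "real \<Rightarrow> real \<Rightarrow> real fps" where
  "degen_exp l x = fps_binomial (x / l) oo (fps_const l * fps_X)"

(* F_{n,l}(x|r). The denominator has constant coefficient 1, so the inverse is the
   genuine one; see degen_fubini_gf. *)
definition degen_fubini :: "real \<Rightarrow> nat \<Rightarrow> real \<Rightarrow> real \<Rightarrow> real" where
  "degen_fubini l n x r =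
     fact n * fps_nth (inverse (1 - fps_const x * (degen_exp l 1 - 1)) * degen_exp l r) n"

definition theta_shift :: "real \<Rightarrow> (real \<Rightarrow> real) \<Rightarrow> real \<Rightarrow> real" where
  "theta_shift c f = (\<lambda>x. x * deriv f x + c * f x)"

(* The operator (x d/dx + r)_{p,l}; the factor with the largest shift acts first. *)
primrec degen_diff_op :: "real \<Rightarrow> real \<Rightarrow> nat \<Rightarrow> (real \<Rightarrow> real) \<Rightarrow> real \<Rightarrow> real" where
  "degen_diff_op l r 0 f = f"
| "degen_diff_op l r (Suc p) f = degen_diff_op l r p (theta_shift (r - real p * l) f)"

lemma degen_exp_nth_gbinomial: "fps_nth (degen_exp l x) n = l ^ n * ((x / l) gchoose n)"
  unfolding degen_exp_def by (simp add: fps_compose_linear)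

lemma degen_exp_nth:
  assumes "l \<noteq> 0"
  shows "fps_nth (degen_exp l x) n = degen_fact l x n / fact n"
proof -
  have "l ^ n * (\<Prod>i<n. x / l - real i) = (\<Prod>i<n. l * (x / l - real i))"
    by (simp add: prod.distrib)
  also have "\<dots> = degen_fact l x n"
    unfolding degen_fact_def using assms by (intro prod.cong) (auto simp: field_simps)
  finally show ?thesis
    by (simp add: degen_exp_nth_gbinomial gbinomial_prod_rev atLeast0LessThan)
qed

lemma degen_exp_sums:
  assumes "\<bar>l * t\<bar> < 1"
  shows "(\<lambda>n. fps_nth (degen_exp l x) n * t ^ n) sums (1 + l * t) powr (x / l)"
  using gen_binomial_real[OF assms, of "x / l"]
  by (simp add: degen_exp_nth_gbinomial power_mult_distrib mult_ac)

lemma degen_fubini_gf: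
  assumes "l \<noteq> 0"
  shows "Abs_fps (\<lambda>n. degen_fubini l n x r / fact n) * (1 - fps_const x * (degen_exp l 1 - 1)) =
    degen_exp l r"
proof -
  let ?D = "1 - fps_const x * (degen_exp l 1 - 1)"
  have "fps_nth ?D 0 \<noteq> 0"
    by (simp add: degen_exp_nth_gbinomial)
  then have "inverse ?D * ?D = 1"
    by (rule inverse_mult_eq_1)
  moreover have "Abs_fps (\<lambda>n. degen_fubini l n x r / fact n) = inverse ?D * degen_exp l r"
    by (rule fps_ext) (simp add: degen_fubini_def)
  ultimately show ?thesis
    by (metis mult.assoc mult.commute mult.left_neutral)
qed

end

theory Submission
  imports Defs
begin

text \<open>
  Write \<open>a k\<close> for the degenerate factorial of \<open>k + r\<close> and \<open>b i\<close> for the binomial coefficient of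
  \<open>m + i\<close> over \<open>i\<close>. Both terms on the left are power series in \<open>x\<close>: comparing generating functions
  in \<open>t\<close> shows that \<open>1 / (1 - x)\<close> times the Fubini polynomial at \<open>x / (1 - x)\<close> is the sum of
  \<open>a k * x ^ k\<close>, so a further factor \<open>1 / (1 - x)\<close> forms partial sums, and the \<open>m\<close>-th derivative
  inserts the factor \<open>b\<close>; the differential operator multiplies the \<open>i\<close>-th coefficient by \<open>a i\<close>.
  The difference has the coefficients \<open>b i * (a 0 + \<dots> + a (i - 1))\<close>, and summation by parts turns
  it into the series on the right.
\<close>

section \<open>Power series on the open unit interval\<close>

text \<open>Values of \<open>f\<close> outside the interval stay unconstrained; as the interval is
  open, derivatives inside it depend only on the series.\<close>

definition disk_series :: "(nat \<Rightarrow> real) \<Rightarrow> (real \<Rightarrow> real) \<Rightarrow> bool" where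
  "disk_series a f \<longleftrightarrow> (\<forall>x. \<bar>x\<bar> < 1 \<longrightarrow> (\<lambda>n. a n * x ^ n) sums f x)"

lemma disk_seriesD: "disk_series a f \<Longrightarrow> \<bar>x\<bar> < 1 \<Longrightarrow> (\<lambda>n. a n * x ^ n) sums f x"
  by (simp add: disk_series_def)

lemma disk_series_summable: "disk_series a f \<Longrightarrow> \<bar>x\<bar> < 1 \<Longrightarrow> summable (\<lambda>n. a n * x ^ n)"
  using disk_seriesD sums_summable by blast

lemma disk_series_cong:
  assumes "disk_series a f" "\<And>n. a n = b n" "\<And>x. \<bar>x\<bar> < 1 \<Longrightarrow> f x = g x"
  shows "disk_series b g"
  using assms by (auto simp: disk_series_def)

lemma disk_series_geometric: "disk_series (\<lambda>n. 1) (\<lambda>x. 1 / (1 - x))"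
  using geometric_sums[where 'a = real] by (auto simp: disk_series_def)

lemma disk_series_has_derivative:
  assumes "disk_series a f" "\<bar>x\<bar> < 1"
  shows "(f has_field_derivative (\<Sum>n. diffs a n * x ^ n)) (at x)"
proof -
  have "((\<lambda>x. \<Sum>n. a n * x ^ n) has_field_derivative (\<Sum>n. diffs a n * x ^ n)) (at x)"
    by (rule termdiffs_strong'[where K = 1])
      (use assms disk_series_summable[OF assms(1)] in auto)
  then show ?thesis
  proof (rule has_field_derivative_transform_within_open[where S = "{-1<..<1}"])
    show "(\<Sum>n. a n * y ^ n) = f y" if "y \<in> {-1<..<1}" for y
      using disk_seriesD[OF assms(1), of y] that by (auto simp: sums_iff)
  qed (use assms in auto)
qed

lemma disk_series_deriv:
  assumes "disk_series a f"
  shows "disk_series (diffs a) (deriv f)"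
  unfolding disk_series_def
proof (intro allI impI)
  fix x :: real assume x: "\<bar>x\<bar> < 1"
  have "summable (\<lambda>n. diffs a n * x ^ n)"
    by (rule termdiff_converges[where K = 1])
      (use x disk_series_summable[OF assms] in auto)
  then show "(\<lambda>n. diffs a n * x ^ n) sums deriv f x"
    using DERIV_imp_deriv[OF disk_series_has_derivative[OF assms x]]
    by (simp add: summable_sums)
qed

text \<open>Each \<open>diffs\<close> shifts the index by one and multiplies by the new index, so
  the factors \<open>n + 1\<close> to \<open>n + m\<close> accumulate.\<close>

lemma funpow_diffs: "(diffs ^^ m) a n = fact (n + m) / fact n * a (n + m :: nat)"
  for a :: "nat \<Rightarrow> real"
proof (induction m arbitrary: n)
  case (Suc m)
  have "(diffs ^^ Suc m) a n = real (Suc n) * (fact (Suc n + m) / fact (Suc n) * a (Suc n + m))"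
    by (simp only: funpow.simps comp_apply diffs_def Suc.IH of_nat_id)
  then show ?case
    by (simp add: fact_Suc divide_simps del: of_nat_Suc)
qed simp

lemma disk_series_higher_deriv:
  assumes "disk_series a f"
  shows "disk_series (\<lambda>n. fact (n + m) / fact n * a (n + m)) ((deriv ^^ m) f)"
proof -
  have "disk_series ((diffs ^^ m) a) ((deriv ^^ m) f)"
    by (induction m) (use assms disk_series_deriv in auto)
  then show ?thesis
    by (rule disk_series_cong) (simp_all add: funpow_diffs)
qed

lemma disk_series_power_mult:
  assumes "disk_series a f"
  shows "disk_series (\<lambda>n. if n < m then 0 else a (n - m)) (\<lambda>x. x ^ m * f x)"
  unfolding disk_series_def
proof (intro allI impI)
  fix x :: real assume x: "\<bar>x\<bar> < 1"
  define c where "c n = (if n < m then 0 else a (n - m)) * x ^ n" for n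
  have "(\<lambda>n. x ^ m * (a n * x ^ n)) sums (x ^ m * f x)"
    by (intro sums_mult disk_seriesD assms x)
  then have "(\<lambda>n. c (n + m)) sums (x ^ m * f x)"
    by (simp add: c_def power_add mult_ac)
  moreover have "(\<Sum>n<m. c n) = 0"
    by (simp add: c_def)
  ultimately have "c sums (x ^ m * f x)"
    by (simp add: sums_iff_shift)
  then show "(\<lambda>n. (if n < m then 0 else a (n - m)) * x ^ n) sums (x ^ m * f x)"
    by (simp add: c_def[abs_def])
qed

section \<open>Action of the degenerate differential operator\<close>

text \<open>The monomial \<open>x ^ n\<close> is an eigenfunction of \<open>x d/dx + c\<close> with
  eigenvalue \<open>n + c\<close>.\<close>

lemma disk_series_theta_shift:
  assumes "disk_series a f"
  shows "disk_series (\<lambda>n. (real n + c) * a n) (theta_shift c f)"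
  unfolding disk_series_def
proof (intro allI impI)
  fix x :: real assume x: "\<bar>x\<bar> < 1"
  have "(\<lambda>n. x * (diffs a n * x ^ n)) sums (x * deriv f x)"
    by (intro sums_mult disk_seriesD disk_series_deriv assms x)
  then have "(\<lambda>n. real (Suc n) * a (Suc n) * x ^ Suc n) sums (x * deriv f x)"
    by (simp add: diffs_def mult_ac)
  \<comment> \<open>The added term at \<open>n = 0\<close> is zero, so the index shift leaves the
    sum unchanged.\<close>
  then have "(\<lambda>n. real n * a n * x ^ n) sums (x * deriv f x)"
    by (subst (asm) sums_Suc_iff) simp
  moreover have "(\<lambda>n. c * (a n * x ^ n)) sums (c * f x)"
    by (intro sums_mult disk_seriesD assms x)
  ultimately have "(\<lambda>n. real n * a n * x ^ n + c * (a n * x ^ n)) sums (x * deriv f x + c * f x)"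
    by (rule sums_add)
  then show "(\<lambda>n. (real n + c) * a n * x ^ n) sums theta_shift c f x"
    by (simp add: theta_shift_def algebra_simps)
qed

text \<open>The eigenvalues \<open>n + r - i * l\<close> of the factors on \<open>x ^ n\<close>
  multiply to the degenerate factorial. The induction varies \<open>a\<close> and \<open>f\<close>
  because the new factor acts on \<open>f\<close> first.\<close>

lemma disk_series_degen_diff_op:
  assumes "disk_series a f"
  shows "disk_series (\<lambda>n. degen_fact l (real n + r) p * a n) (degen_diff_op l r p f)"
  using assms
proof (induction p arbitrary: a f)
  case 0
  then show ?case by (simp add: degen_fact_def)
next
  case (Suc p)
  show ?case
    using Suc.IH[OF disk_series_theta_shift[OF Suc.prems]]
    by (rule disk_series_cong) (simp_all add: degen_fact_def algebra_simps)
qed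

section \<open>Absolute convergence and Cauchy products\<close>

lemma disk_series_summable_abs:
  assumes "disk_series a f" "\<bar>x\<bar> < 1"
  shows "summable (\<lambda>n. \<bar>a n * x ^ n\<bar>)"
proof -
  obtain y where y: "\<bar>x\<bar> < y" "y < 1"
    using assms(2) dense by blast
  have "summable (\<lambda>n. norm (a n * x ^ n))"
    by (rule powser_insidea[OF disk_series_summable[OF assms(1), of y]]) (use y in auto)
  then show ?thesis by simp
qed

text \<open>Lets the series lemmas be applied to \<open>\<bar>a n\<bar>\<close> as well, which
  supplies the dominating series for the summation by parts.\<close>

lemma disk_series_abs:
  assumes "disk_series a f"
  shows "disk_series (\<lambda>n. \<bar>a n\<bar>) (\<lambda>x. \<Sum>n. \<bar>a n\<bar> * x ^ n)"
  unfolding disk_series_def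
proof (intro allI impI summable_sums)
  fix x :: real assume x: "\<bar>x\<bar> < 1"
  show "summable (\<lambda>n. \<bar>a n\<bar> * x ^ n)"
    by (rule summable_rabs_cancel)
      (use disk_series_summable_abs[OF assms x] in \<open>simp add: abs_mult\<close>)
qed

text \<open>This is the Cauchy product with the geometric series.\<close>

lemma disk_series_partial_sums:
  assumes "disk_series a f"
  shows "disk_series (\<lambda>n. \<Sum>k\<le>n. a k) (\<lambda>x. f x / (1 - x))"
  unfolding disk_series_def
proof (intro allI impI)
  fix x :: real assume x: "\<bar>x\<bar> < 1"
  have "(\<lambda>n. \<Sum>k\<le>n. (a k * x ^ k) * (1 * x ^ (n - k))) sums
      ((\<Sum>n. a n * x ^ n) * (\<Sum>n. 1 * x ^ n))"
    by (rule Cauchy_product_sums)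
      (use disk_series_summable_abs[OF assms x]
         disk_series_summable_abs[OF disk_series_geometric x] in simp_all)
  moreover have "(\<Sum>n. a n * x ^ n) = f x" "(\<Sum>n. 1 * x ^ n) = 1 / (1 - x)"
    using disk_seriesD[OF assms x] disk_seriesD[OF disk_series_geometric x]
    by (simp_all only: sums_iff)
  moreover have "(\<Sum>k\<le>n. (a k * x ^ k) * (1 * x ^ (n - k))) = (\<Sum>k\<le>n. a k) * x ^ n" for n
    unfolding sum_distrib_right
    by (rule sum.cong) (simp_all add: mult.assoc flip: power_add)
  ultimately show "(\<lambda>n. (\<Sum>k\<le>n. a k) * x ^ n) sums (f x / (1 - x))"
    by simp
qed

text \<open>Each further factor \<open>1 / (1 - x)\<close> takes partial sums of the coefficients,
  and the hockey-stick identity evaluates them.\<close>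

lemma disk_series_binomial:
  "disk_series (\<lambda>n. real ((m + n) choose n)) (\<lambda>x. (1 / (1 - x)) ^ (m + 1))"
proof (induction m)
  case 0
  then show ?case using disk_series_geometric by simp
next
  case (Suc m)
  show ?case
    using disk_series_partial_sums[OF Suc]
  proof (rule disk_series_cong)
    show "(\<Sum>k\<le>n. real ((m + k) choose k)) = real ((Suc m + n) choose n)" for n
      using sum_choose_lower[of m n] by (simp flip: of_nat_sum)
  qed (simp add: divide_simps)
qed

section \<open>Generating function of the degenerate Fubini polynomials\<close>

lemma degen_exp_add: "degen_exp l (a + b) = degen_exp l a * degen_exp l b"
  by (simp add: degen_exp_def add_divide_distrib fps_binomial_add_mult fps_compose_mult_distrib)

text \<open>As a power series in \<open>t\<close>, the sum over \<open>k\<close> of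
  \<open>x ^ k * degen_exp l (k + r)\<close> is
  \<open>degen_exp l r / (1 - x * degen_exp l 1)\<close>. This denominator is \<open>1 - x\<close>
  times the Fubini denominator at \<open>x / (1 - x)\<close>.\<close>

lemma disk_series_degen_fubini:
  assumes "l \<noteq> 0"
  shows "disk_series (\<lambda>k. degen_fact l (real k + r) p)
    (\<lambda>x. degen_fubini l p (x / (1 - x)) r / (1 - x))"
  unfolding disk_series_def
proof (intro allI impI)
  fix x :: real assume x: "\<bar>x\<bar> < 1"
  define E where "E k = degen_exp l (real k + r)" for k
  \<comment> \<open>\<open>G n\<close> is the sum over \<open>k\<close> of \<open>x ^ k\<close>
    times the \<open>n\<close>-th coefficient of \<open>E k\<close>; expressing it by the operator
    on \<open>1 / (1 - x)\<close> gives convergence at once.\<close>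
  define G where "G n = degen_diff_op l r n (\<lambda>x. 1 / (1 - x)) x / fact n" for n
  have E_Suc: "E (Suc k) = E k * degen_exp l 1" for k
    unfolding E_def by (simp flip: degen_exp_add add: add_ac)
  have nth: "fps_nth (E k) n = degen_fact l (real k + r) n / fact n" for k n
    by (simp add: E_def degen_exp_nth assms)
  have G0: "(\<lambda>k. degen_fact l (real k + r) n * x ^ k) sums (G n * fact n)" for n
    using disk_seriesD[OF disk_series_degen_diff_op[OF disk_series_geometric] x, of l r n]
    by (simp add: G_def)
  have G: "(\<lambda>k. fps_nth (E k) n * x ^ k) sums G n" for n
    using sums_divide[OF G0, of n "fact n"] by (simp add: nth)
  \<comment> \<open>Multiplication by \<open>x * degen_exp l 1\<close> shifts \<open>k\<close> to
    \<open>k + 1\<close>, which drops only the term \<open>E 0\<close>. For a fixed coefficient in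
    \<open>t\<close>, the series over \<open>k\<close> is interchanged with a finite sum
    only.\<close>
  have conv: "fps_nth (Abs_fps G * degen_exp l 1) n * x = G n - fps_nth (E 0) n" for n
  proof -
    have "(\<lambda>k. \<Sum>i=0..n. fps_nth (E k) i * x ^ k * fps_nth (degen_exp l 1) (n - i)) sums
        (\<Sum>i=0..n. G i * fps_nth (degen_exp l 1) (n - i))"
      by (intro sums_sum sums_mult2 G)
    also have "(\<lambda>k. \<Sum>i=0..n. fps_nth (E k) i * x ^ k * fps_nth (degen_exp l 1) (n - i)) =
        (\<lambda>k. fps_nth (E (Suc k)) n * x ^ k)"
      by (simp add: E_Suc fps_mult_nth sum_distrib_left mult_ac)
    finally have "(\<lambda>k. fps_nth (E (Suc k)) n * x ^ k * x) sums
        (fps_nth (Abs_fps G * degen_exp l 1) n * x)"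
      by (intro sums_mult2) (simp add: fps_mult_nth)
    moreover have "(\<lambda>k. fps_nth (E (Suc k)) n * x ^ Suc k) sums (G n - fps_nth (E 0) n)"
      using G[of n] by (subst sums_Suc_iff) simp
    ultimately show ?thesis
      by (auto simp: mult_ac intro: sums_unique2)
  qed
  define X where "X = x / (1 - x)"
  define D where "D = 1 - fps_const X * (degen_exp l 1 - 1)"
  have X: "(1 - x) * X = x"
    using x by (simp add: X_def)
  have "fps_const (1 - x) * D = 1 - fps_const x * degen_exp l 1"
  proof -
    have "fps_const (1 - x) * D = fps_const (1 - x) - fps_const ((1 - x) * X) * (degen_exp l 1 - 1)"
      by (simp add: D_def right_diff_distrib mult.assoc flip: fps_const_mult)
    also have "\<dots> = 1 - fps_const x * degen_exp l 1"
      unfolding X by (simp add: algebra_simps flip: fps_const_sub)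
    finally show ?thesis .
  qed
  moreover have "Abs_fps G * (1 - fps_const x * degen_exp l 1) = E 0"
  proof (rule fps_ext)
    fix n
    have "Abs_fps G * (1 - fps_const x * degen_exp l 1) =
        Abs_fps G - Abs_fps G * degen_exp l 1 * fps_const x"
      by (simp add: algebra_simps)
    then show "fps_nth (Abs_fps G * (1 - fps_const x * degen_exp l 1)) n = fps_nth (E 0) n"
      using conv[of n] by simp
  qed
  ultimately have GD: "Abs_fps G * fps_const (1 - x) * D = degen_exp l r"
    by (simp add: mult.assoc E_def)
  \<comment> \<open>\<open>degen_exp l 1\<close> has constant coefficient 1, hence so does
    \<open>D\<close>.\<close>
  have "fps_nth D 0 \<noteq> 0"
    by (simp add: D_def degen_exp_nth_gbinomial)
  then have "inverse D * D = 1"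
    by (rule inverse_mult_eq_1)
  then have "Abs_fps G * fps_const (1 - x) = inverse D * degen_exp l r"
    using GD by (metis mult.assoc mult.commute mult.right_neutral)
  then have "degen_fubini l p X r = fact p * fps_nth (Abs_fps G * fps_const (1 - x)) p"
    by (simp add: degen_fubini_def D_def)
  then have "degen_fubini l p X r / (1 - x) = G p * fact p"
    using x by (simp add: field_simps)
  then show "(\<lambda>k. degen_fact l (real k + r) p * x ^ k) sums
      (degen_fubini l p (x / (1 - x)) r / (1 - x))"
    using G0[of p] by (simp add: X_def)
qed

section \<open>Summation by parts\<close>

text \<open>The factor of \<open>a k\<close> is the tail of \<open>c\<close> over
  \<open>i > k\<close>; exchanging the order of summation pairs \<open>c i\<close> with the
  \<open>a k\<close> for \<open>k < i\<close>. The hypothesis \<open>abs\<close> makes the boundary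
  term vanish.\<close>

lemma sums_mult_tails:
  fixes a c :: "nat \<Rightarrow> real"
  assumes "c sums S"
    and abs: "summable (\<lambda>i. (\<Sum>k\<le>i. \<bar>a k\<bar>) * \<bar>c i\<bar>)"
    and T: "(\<lambda>i. (\<Sum>k<i. a k) * c i) sums T"
  shows "(\<lambda>k. a k * (S - (\<Sum>i\<le>k. c i))) sums T"
proof -
  define B where "B n = (\<Sum>k\<le>n. \<bar>a k\<bar>)" for n
  define R where "R n = (\<Sum>i. B (i + Suc n) * \<bar>c (i + Suc n)\<bar>)" for n
  have tail: "(\<lambda>i. c (i + Suc n)) sums (S - (\<Sum>i\<le>n. c i))" for n
    using sums_split_initial_segment[OF assms(1), of "Suc n"] by (simp add: lessThan_Suc_atMost)
  have parts: "(\<Sum>k\<le>n. a k * (S - (\<Sum>i\<le>k. c i))) =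
      (\<Sum>k\<le>n. a k) * (S - (\<Sum>i\<le>n. c i)) + (\<Sum>i\<le>n. (\<Sum>k<i. a k) * c i)" for n
    by (induction n) (simp_all add: algebra_simps lessThan_Suc_atMost)
  \<comment> \<open>The partial sum of \<open>a\<close> up to \<open>n\<close> is at most
    \<open>B n\<close>, and \<open>B\<close> is nondecreasing, so it can be moved inside the tail as
    \<open>B (i + Suc n)\<close>.\<close>
  have bound: "norm ((\<Sum>k\<le>n. a k) * (S - (\<Sum>i\<le>n. c i))) \<le> R n" for n
  proof -
    have summ: "summable (\<lambda>i. B (i + Suc n) * \<bar>c (i + Suc n)\<bar>)"
      using summable_ignore_initial_segment[OF abs, of "Suc n"] by (simp add: B_def)
    have le: "norm ((\<Sum>k\<le>n. a k) * c (i + Suc n)) \<le> B (i + Suc n) * \<bar>c (i + Suc n)\<bar>" for i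
    proof -
      have "\<bar>\<Sum>k\<le>n. a k\<bar> \<le> B n"
        unfolding B_def by (rule sum_abs)
      also have "\<dots> \<le> B (i + Suc n)"
        unfolding B_def by (rule sum_mono2) auto
      finally show ?thesis by (simp add: abs_mult mult_right_mono)
    qed
    have "norm (\<Sum>i. (\<Sum>k\<le>n. a k) * c (i + Suc n)) \<le> R n"
      unfolding R_def by (rule norm_suminf_le[OF le summ])
    then show ?thesis
      using sums_unique[OF sums_mult[OF tail, of "\<Sum>k\<le>n. a k" n]] by simp
  qed
  have "(\<lambda>n. R n) \<longlonglongrightarrow> 0"
  proof -
    \<comment> \<open>\<open>R\<close> is this sequence of tails of a convergent series, shifted by
      one.\<close>
    have "(\<lambda>n. \<Sum>i. B (i + n) * \<bar>c (i + n)\<bar>) \<longlonglongrightarrow> 0"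
      using suminf_exist_split2[OF abs] by (simp add: B_def)
    then show ?thesis
      unfolding R_def by (rule LIMSEQ_Suc)
  qed
  then have "(\<lambda>n. (\<Sum>k\<le>n. a k) * (S - (\<Sum>i\<le>n. c i))) \<longlonglongrightarrow> 0"
    by (rule Lim_null_comparison[rotated]) (use bound in simp)
  from tendsto_add[OF this T[unfolded sums_def_le]] show ?thesis
    by (simp add: sums_def_le parts)
qed

section \<open>Assembling the identity\<close>

text \<open>The factor \<open>y ^ m\<close> moves \<open>a n\<close> to index \<open>n + m\<close>,
  and \<open>m\<close> derivatives bring it back with the factor
  \<open>(n + m)! / n!\<close>.\<close>

lemma disk_series_binomial_higher_deriv:
  assumes "disk_series a f"
  shows "disk_series (\<lambda>n. real ((m + n) choose n) * a n)
    (\<lambda>x. 1 / fact m * (deriv ^^ m) (\<lambda>y. y ^ m * f y) x)"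
  unfolding disk_series_def
proof (intro allI impI)
  fix x :: real assume "\<bar>x\<bar> < 1"
  from sums_mult[OF disk_seriesD[OF disk_series_higher_deriv[OF disk_series_power_mult[OF assms]] this],
      of "1 / fact m" m m]
  show "(\<lambda>n. real ((m + n) choose n) * a n * x ^ n) sums
      (1 / fact m * (deriv ^^ m) (\<lambda>y. y ^ m * f y) x)"
    by (simp add: binomial_fact add.commute mult_ac)
qed

theorem theorem10:
  fixes l x :: real and r m p :: nat
  assumes "l \<noteq> 0" and "\<bar>x\<bar> < 1"
  shows "(\<lambda>k. degen_fact l (real k + real r) p *
              ((1 / (1 - x)) ^ (m + 1) - (\<Sum>i=0..k. real ((m + i) choose i) * x ^ i)))
         sums
         (1 / fact m *
            (deriv ^^ m) (\<lambda>y. y ^ m / (1 - y)\<^sup>2 * degen_fubini l p (y / (1 - y)) (real r)) x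
          - degen_diff_op l (real r) p (\<lambda>y. (1 / (1 - y)) ^ (m + 1)) x)"
proof -
  define a where "a k = degen_fact l (real k + real r) p" for k
  define b where "b i = real ((m + i) choose i)" for i
  have a: "disk_series a (\<lambda>x. degen_fubini l p (x / (1 - x)) r / (1 - x))"
    unfolding a_def[abs_def] by (rule disk_series_degen_fubini[OF assms(1)])
  have b: "disk_series b (\<lambda>x. (1 / (1 - x)) ^ (m + 1))"
    unfolding b_def[abs_def] by (rule disk_series_binomial)
  \<comment> \<open>One factor \<open>1 / (1 - y)\<close> belongs to the Fubini series, the other
    comes from taking partial sums.\<close>
  have "(\<lambda>y. y ^ m * (degen_fubini l p (y / (1 - y)) r / (1 - y) / (1 - y))) =
      (\<lambda>y. y ^ m / (1 - y)\<^sup>2 * degen_fubini l p (y / (1 - y)) (real r))"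
    by (simp add: power2_eq_square)
  then have 1: "(\<lambda>i. b i * (\<Sum>k\<le>i. a k) * x ^ i) sums (1 / fact m *
      (deriv ^^ m) (\<lambda>y. y ^ m / (1 - y)\<^sup>2 * degen_fubini l p (y / (1 - y)) (real r)) x)"
    using disk_seriesD[OF disk_series_binomial_higher_deriv[OF disk_series_partial_sums[OF a]]
        assms(2), of m]
    by (simp add: b_def)
  have 2: "(\<lambda>i. a i * b i * x ^ i) sums degen_diff_op l (real r) p (\<lambda>y. (1 / (1 - y)) ^ (m + 1)) x"
    unfolding a_def by (rule disk_seriesD[OF disk_series_degen_diff_op[OF b] assms(2)])
  have "(\<lambda>k. a k * ((1 / (1 - x)) ^ (m + 1) - (\<Sum>i\<le>k. b i * x ^ i))) sums
      (1 / fact m *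
        (deriv ^^ m) (\<lambda>y. y ^ m / (1 - y)\<^sup>2 * degen_fubini l p (y / (1 - y)) (real r)) x
      - degen_diff_op l (real r) p (\<lambda>y. (1 / (1 - y)) ^ (m + 1)) x)"
  proof (rule sums_mult_tails)
    show "(\<lambda>i. b i * x ^ i) sums (1 / (1 - x)) ^ (m + 1)"
      by (rule disk_seriesD[OF b assms(2)])
    \<comment> \<open>The expansion behind fact \<open>1\<close>, applied to
      \<open>\<bar>a k\<bar>\<close> in place of \<open>a k\<close>, converges absolutely at
      \<open>x\<close>.\<close>
    show "summable (\<lambda>i. (\<Sum>k\<le>i. \<bar>a k\<bar>) * \<bar>b i * x ^ i\<bar>)"
      using disk_series_summable_abs[OF
          disk_series_binomial_higher_deriv[OF disk_series_partial_sums[OF disk_series_abs[OF a]]]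
          assms(2), of m]
      by (simp add: b_def abs_mult sum_nonneg mult_ac)
    \<comment> \<open>Subtracting the operator series removes exactly the diagonal term
      \<open>k = i\<close>.\<close>
    have "(\<Sum>k<i. a k) * (b i * x ^ i) = b i * (\<Sum>k\<le>i. a k) * x ^ i - a i * b i * x ^ i" for i
      by (simp add: algebra_simps flip: lessThan_Suc_atMost)
    then show "(\<lambda>i. (\<Sum>k<i. a k) * (b i * x ^ i)) sums
        (1 / fact m *
          (deriv ^^ m) (\<lambda>y. y ^ m / (1 - y)\<^sup>2 * degen_fubini l p (y / (1 - y)) (real r)) x
        - degen_diff_op l (real r) p (\<lambda>y. (1 / (1 - y)) ^ (m + 1)) x)"
      using sums_diff[OF 1 2] by simp
  qed
  then show ?thesis
    by (simp add: a_def b_def atLeast0AtMost)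
qed

end
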